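(* Let $L$ be a $\kappa$-frame. Every quotient of $L$ (i.e. every $\kappa$-frame $L/C$ with $C$ a congruence on $L$) is clear if and only if $L$ is Boolean.
   Context: Here $\kappa$ is either an infinite regular cardinal or the symbol $\infty$. A $\kappa$-set is a set of cardinality less than $\kappa$ (any set if $\kappa=\infty$). A $\kappa$-frame is a bounded distributive lattice with joins of all $\kappa$-sets, over which binary meets distribute; for $\kappa=\infty$ this is a frame. A congruence on $L$ is an equivalence relation on $L$ closed under finite meets and $\kappa$-joins in $L\times L$. A $\kappa$-frame is Boolean if every element is complemented. A $\kappa$-frame $M$ has a largest dense congruence $\mathfrak{D}_M=\{(a,b)\mid \forall x\in M:\ a\wedge x=0\iff b\wedge x=0\}$ (a congruence $C$ is dense if $(0,a)\in C$ implies $a=0$), and $M$ is called clear if $\mathfrak{D}_M$ is the equality relation. *)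

theory Defs
  imports "HOL-Algebra.Lattice"
begin

unbundle cardinal_syntax

text \<open>
  \<open>\<kappa>\<close> is given as an option: \<open>None\<close> stands for the symbol \<open>\<infinity>\<close>, and \<open>Some r\<close> for the infinite
  regular cardinal \<open>r\<close>.  The type \<open>'k\<close> on which \<open>r\<close> lives is unrelated to the type of the elements
  of the frame.
\<close>

fun regular_or_infty :: "'k rel option \<Rightarrow> bool" where
  "regular_or_infty None \<longleftrightarrow> True"
| "regular_or_infty (Some r) \<longleftrightarrow> Cinfinite r \<and> regularCard r"

fun kset :: "'k rel option \<Rightarrow> 'a set \<Rightarrow> bool" where
  "kset None A \<longleftrightarrow> True"
| "kset (Some r) A \<longleftrightarrow> |A| <o r"

locale kframe = bounded_lattice L for L :: "('a, 'm) gorder_scheme" (structure) +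
  fixes \<kappa> :: "'k rel option"
  assumes kappa: "regular_or_infty \<kappa>"
    and meet_join_distrib:
      "\<lbrakk>x \<in> carrier L; y \<in> carrier L; z \<in> carrier L\<rbrakk> \<Longrightarrow> x \<sqinter> (y \<squnion> z) = (x \<sqinter> y) \<squnion> (x \<sqinter> z)"
    and kjoin_exists:
      "\<lbrakk>A \<subseteq> carrier L; kset \<kappa> A\<rbrakk> \<Longrightarrow> \<exists>s. is_lub L s A"
    and meet_kjoin_distrib:
      "\<lbrakk>x \<in> carrier L; A \<subseteq> carrier L; kset \<kappa> A\<rbrakk> \<Longrightarrow> x \<sqinter> \<Squnion>A = \<Squnion>((\<lambda>a. x \<sqinter> a) ` A)"

text \<open>
  Meets and joins in \<open>L \<times> L\<close> are computed componentwise.  Closure under the empty meet is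
  reflexivity at \<open>\<top>\<close>.
\<close>

definition kcongruence :: "('a, 'm) gorder_scheme \<Rightarrow> 'k rel option \<Rightarrow> 'a rel \<Rightarrow> bool" where
  "kcongruence L \<kappa> C \<longleftrightarrow>
     equiv (carrier L) C \<and>
     (\<forall>a b c d. (a, b) \<in> C \<longrightarrow> (c, d) \<in> C \<longrightarrow> (a \<sqinter>\<^bsub>L\<^esub> c, b \<sqinter>\<^bsub>L\<^esub> d) \<in> C) \<and>
     (\<forall>R. R \<subseteq> C \<longrightarrow> kset \<kappa> R \<longrightarrow> (\<Squnion>\<^bsub>L\<^esub>(fst ` R), \<Squnion>\<^bsub>L\<^esub>(snd ` R)) \<in> C)"

text \<open>
  The \<open>\<kappa>\<close>-frame \<open>L/C\<close>, given by its order.  Lemmas \<open>kframe_quotient\<close>, \<open>quotient_meet\<close>,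
  \<open>quotient_join\<close> and \<open>quotient_sup\<close> below show that for a congruence this is a \<open>\<kappa>\<close>-frame and that
  its operations are those induced by \<open>L\<close> on equivalence classes.
\<close>

definition quotient_kframe :: "('a, 'm) gorder_scheme \<Rightarrow> 'a rel \<Rightarrow> 'a set gorder" where
  "quotient_kframe L C =
     \<lparr> carrier = carrier L // C, eq = (=), le = (\<lambda>X Y. \<exists>x\<in>X. \<exists>y\<in>Y. x \<sqsubseteq>\<^bsub>L\<^esub> y) \<rparr>"

definition boolean_kframe :: "('a, 'm) gorder_scheme \<Rightarrow> bool" where
  "boolean_kframe L \<longleftrightarrow>
     (\<forall>a\<in>carrier L. \<exists>b\<in>carrier L. a \<sqinter>\<^bsub>L\<^esub> b = \<bottom>\<^bsub>L\<^esub> \<and> a \<squnion>\<^bsub>L\<^esub> b = \<top>\<^bsub>L\<^esub>)"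

definition dense_kcongruence :: "('a, 'm) gorder_scheme \<Rightarrow> 'k rel option \<Rightarrow> 'a rel \<Rightarrow> bool" where
  "dense_kcongruence M \<kappa> C \<longleftrightarrow> kcongruence M \<kappa> C \<and> (\<forall>a. (\<bottom>\<^bsub>M\<^esub>, a) \<in> C \<longrightarrow> a = \<bottom>\<^bsub>M\<^esub>)"

definition largest_dense :: "('a, 'm) gorder_scheme \<Rightarrow> 'a rel" where
  "largest_dense M =
     {(a, b). a \<in> carrier M \<and> b \<in> carrier M \<and>
        (\<forall>x\<in>carrier M. a \<sqinter>\<^bsub>M\<^esub> x = \<bottom>\<^bsub>M\<^esub> \<longleftrightarrow> b \<sqinter>\<^bsub>M\<^esub> x = \<bottom>\<^bsub>M\<^esub>)}"

definition clear_kframe :: "('a, 'm) gorder_scheme \<Rightarrow> bool" where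
  "clear_kframe M \<longleftrightarrow> largest_dense M = Id_on (carrier M)"


lemma kset_mono: "kset \<kappa> A \<Longrightarrow> B \<subseteq> A \<Longrightarrow> kset \<kappa> B"
  by (cases \<kappa>) (auto intro: ordLeq_ordLess_trans card_of_mono1)

lemma kset_image: "kset \<kappa> A \<Longrightarrow> kset \<kappa> (f ` A)"
  by (cases \<kappa>) (auto intro: ordLeq_ordLess_trans card_of_image)

lemma kset_finite: "regular_or_infty \<kappa> \<Longrightarrow> finite A \<Longrightarrow> kset \<kappa> A"
  by (cases \<kappa>)
    (auto simp: cinfinite_def card_order_on_well_order_on
      intro!: finite_ordLess_infinite[OF card_of_Well_order] simp: Field_card_of)

lemma (in partial_order) sup_eqI: "is_lub L s A \<Longrightarrow> \<Squnion>A = s"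
  unfolding Lattice.sup_def by (rule some_equality) (auto intro: least_unique)

lemma (in partial_order) inf_eqI: "is_glb L s A \<Longrightarrow> \<Sqinter>A = s"
  unfolding Lattice.inf_def by (rule some_equality) (auto intro: greatest_unique)

context kframe
begin

lemma kjoin_lub: "\<lbrakk>A \<subseteq> carrier L; kset \<kappa> A\<rbrakk> \<Longrightarrow> is_lub L (\<Squnion>A) A"
  using kjoin_exists sup_eqI by metis

lemma kjoin_closed: "\<lbrakk>A \<subseteq> carrier L; kset \<kappa> A\<rbrakk> \<Longrightarrow> \<Squnion>A \<in> carrier L"
  using kjoin_lub least_closed by metis

lemma kjoin_upper: "\<lbrakk>A \<subseteq> carrier L; kset \<kappa> A; x \<in> A\<rbrakk> \<Longrightarrow> x \<sqsubseteq> \<Squnion>A"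
  using kjoin_lub least_Upper_above by metis

lemma kjoin_least:
  "\<lbrakk>A \<subseteq> carrier L; kset \<kappa> A; y \<in> carrier L; \<And>x. x \<in> A \<Longrightarrow> x \<sqsubseteq> y\<rbrakk> \<Longrightarrow> \<Squnion>A \<sqsubseteq> y"
  using kjoin_lub least_le Upper_memI by metis

lemma le_meet_eq: "\<lbrakk>x \<sqsubseteq> y; x \<in> carrier L; y \<in> carrier L\<rbrakk> \<Longrightarrow> x \<sqinter> y = x"
  by (metis le_iff_join)

lemma meet_assoc': "\<lbrakk>x \<in> carrier L; y \<in> carrier L; z \<in> carrier L\<rbrakk> \<Longrightarrow> (x \<sqinter> y) \<sqinter> z = x \<sqinter> (y \<sqinter> z)"
  using weak_meet_assoc eq_is_equal by metis

lemma le_bottom: "\<lbrakk>x \<sqsubseteq> \<bottom>; x \<in> carrier L\<rbrakk> \<Longrightarrow> x = \<bottom>"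
  by (metis bottom_closed bottom_lower le_antisym)

context
  fixes C
  assumes C: "kcongruence L \<kappa> C"
begin

lemma cong_equiv: "equiv (carrier L) C"
  using C by (simp add: kcongruence_def)

lemma cong_carrier: "(a, b) \<in> C \<Longrightarrow> a \<in> carrier L \<and> b \<in> carrier L"
  using cong_equiv by (auto simp: equiv_def refl_on_def)

lemma cong_refl: "a \<in> carrier L \<Longrightarrow> (a, a) \<in> C"
  using cong_equiv by (auto simp: equiv_def refl_on_def)

lemma cong_sym: "(a, b) \<in> C \<Longrightarrow> (b, a) \<in> C"
  using cong_equiv by (auto simp: equiv_def dest: symD)

lemma cong_trans: "(a, b) \<in> C \<Longrightarrow> (b, c) \<in> C \<Longrightarrow> (a, c) \<in> C"
  using cong_equiv by (auto simp: equiv_def dest: transD)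

lemma cong_meet: "(a, b) \<in> C \<Longrightarrow> (c, d) \<in> C \<Longrightarrow> (a \<sqinter> c, b \<sqinter> d) \<in> C"
  using C by (simp add: kcongruence_def)

lemma cong_sup: "R \<subseteq> C \<Longrightarrow> kset \<kappa> R \<Longrightarrow> (\<Squnion>(fst ` R), \<Squnion>(snd ` R)) \<in> C"
  using C by (simp add: kcongruence_def)

lemma cong_join: "(a, b) \<in> C \<Longrightarrow> (c, d) \<in> C \<Longrightarrow> (a \<squnion> c, b \<squnion> d) \<in> C"
  using cong_sup[of "{(a, b), (c, d)}"] by (simp add: join_def kset_finite kappa)

abbreviation Q where "Q \<equiv> quotient_kframe L C"

lemma carrier_Q: "carrier Q = (\<lambda>x. C `` {x}) ` carrier L"
  by (auto simp: quotient_kframe_def quotient_def)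

lemma Q_eq_iff: "\<lbrakk>x \<in> carrier L; y \<in> carrier L\<rbrakk> \<Longrightarrow> C `` {x} = C `` {y} \<longleftrightarrow> (x, y) \<in> C"
  using cong_equiv eq_equiv_class_iff by metis

lemma Q_le_iff:
  assumes "x \<in> carrier L" "y \<in> carrier L"
  shows "C `` {x} \<sqsubseteq>\<^bsub>Q\<^esub> C `` {y} \<longleftrightarrow> (x \<sqinter> y, x) \<in> C"
proof
  assume "C `` {x} \<sqsubseteq>\<^bsub>Q\<^esub> C `` {y}"
  then obtain u v where uv: "(x, u) \<in> C" "(y, v) \<in> C" "u \<sqsubseteq> v"
    by (auto simp: quotient_kframe_def)
  then have "u \<sqinter> v = u" using le_meet_eq cong_carrier by blast
  then show "(x \<sqinter> y, x) \<in> C" using cong_meet[OF uv(1,2)] uv(1) cong_sym cong_trans by metis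
next
  assume "(x \<sqinter> y, x) \<in> C"
  then have "x \<sqinter> y \<in> C `` {x}" "y \<in> C `` {y}" "x \<sqinter> y \<sqsubseteq> y"
    using assms cong_sym cong_refl meet_right by blast+
  then show "C `` {x} \<sqsubseteq>\<^bsub>Q\<^esub> C `` {y}"
    unfolding quotient_kframe_def by auto
qed

lemma Q_le: "\<lbrakk>x \<in> carrier L; y \<in> carrier L; x \<sqsubseteq> y\<rbrakk> \<Longrightarrow> C `` {x} \<sqsubseteq>\<^bsub>Q\<^esub> C `` {y}"
  by (simp add: Q_le_iff le_meet_eq cong_refl)

lemma Q_partial_order: "partial_order Q"
proof
  fix X Y Z assume "X \<sqsubseteq>\<^bsub>Q\<^esub> Y" "Y \<sqsubseteq>\<^bsub>Q\<^esub> Z" "X \<in> carrier Q" "Y \<in> carrier Q" "Z \<in> carrier Q"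
  then obtain x y z where *: "x \<in> carrier L" "y \<in> carrier L" "z \<in> carrier L"
    "X = C `` {x}" "Y = C `` {y}" "Z = C `` {z}" by (auto simp: carrier_Q)
  with \<open>X \<sqsubseteq>\<^bsub>Q\<^esub> Y\<close> \<open>Y \<sqsubseteq>\<^bsub>Q\<^esub> Z\<close> have 1: "(x \<sqinter> y, x) \<in> C" "(y \<sqinter> z, y) \<in> C"
    by (simp_all add: Q_le_iff)
  have "((x \<sqinter> y) \<sqinter> z, x \<sqinter> z) \<in> C" using cong_meet 1(1) cong_refl *(3) by blast
  moreover have "(x \<sqinter> (y \<sqinter> z), x \<sqinter> y) \<in> C" using cong_meet 1(2) cong_refl *(1) by blast
  ultimately have "(x \<sqinter> z, x) \<in> C"
    using 1(1) cong_sym cong_trans meet_assoc' *(1-3) by metis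
  then show "X \<sqsubseteq>\<^bsub>Q\<^esub> Z" using * by (simp add: Q_le_iff)
next
  have anti: "X = Y" if "X \<sqsubseteq>\<^bsub>Q\<^esub> Y" "Y \<sqsubseteq>\<^bsub>Q\<^esub> X" "X \<in> carrier Q" "Y \<in> carrier Q" for X Y
  proof -
    obtain x y where *: "x \<in> carrier L" "y \<in> carrier L" "X = C `` {x}" "Y = C `` {y}"
      using \<open>X \<in> carrier Q\<close> \<open>Y \<in> carrier Q\<close> by (auto simp: carrier_Q)
    with \<open>X \<sqsubseteq>\<^bsub>Q\<^esub> Y\<close> \<open>Y \<sqsubseteq>\<^bsub>Q\<^esub> X\<close> have "(x \<sqinter> y, x) \<in> C" "(x \<sqinter> y, y) \<in> C"
      by (simp_all add: Q_le_iff meet_comm)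
    then show ?thesis using * Q_eq_iff cong_sym cong_trans by metis
  qed
  show "X .=\<^bsub>Q\<^esub> Y" if "X \<sqsubseteq>\<^bsub>Q\<^esub> Y" "Y \<sqsubseteq>\<^bsub>Q\<^esub> X" "X \<in> carrier Q" "Y \<in> carrier Q" for X Y
    using anti[OF that] by (simp add: quotient_kframe_def)
  show "X \<sqsubseteq>\<^bsub>Q\<^esub> X" if "X \<in> carrier Q" for X
    using that Q_le by (auto simp: carrier_Q)
qed (auto simp: quotient_kframe_def)

lemma Q_glb:
  assumes "x \<in> carrier L" "y \<in> carrier L"
  shows "is_glb Q (C `` {x \<sqinter> y}) {C `` {x}, C `` {y}}"
proof (rule greatest_LowerI)
  fix Z assume Z: "Z \<in> Lower Q {C `` {x}, C `` {y}}"
  then obtain z where z: "z \<in> carrier L" "Z = C `` {z}"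
    by (auto simp: Lower_def carrier_Q)
  have "(z \<sqinter> x, z) \<in> C" "(z \<sqinter> y, z) \<in> C"
    using Z assms z(1) unfolding z(2) by (simp_all add: Lower_def carrier_Q Q_le_iff)
  then have "((z \<sqinter> x) \<sqinter> y, z) \<in> C"
    using cong_meet[of "z \<sqinter> x" z y y] cong_refl assms(2) cong_trans by blast
  then show "Z \<sqsubseteq>\<^bsub>Q\<^esub> C `` {x \<sqinter> y}" using z assms by (simp add: Q_le_iff meet_assoc')
next
  fix X assume "X \<in> {C `` {x}, C `` {y}}"
  then show "C `` {x \<sqinter> y} \<sqsubseteq>\<^bsub>Q\<^esub> X"
    using assms Q_le[OF _ _ meet_left] Q_le[OF _ _ meet_right] by auto
qed (use assms in \<open>auto simp: carrier_Q\<close>)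

lemma Q_lub:
  assumes A: "A \<subseteq> carrier L" "kset \<kappa> A"
  shows "is_lub Q (C `` {\<Squnion>A}) ((\<lambda>x. C `` {x}) ` A)"
proof (rule least_UpperI)
  fix X assume "X \<in> (\<lambda>x. C `` {x}) ` A"
  then show "X \<sqsubseteq>\<^bsub>Q\<^esub> C `` {\<Squnion>A}"
    using A kjoin_closed kjoin_upper by (auto intro!: Q_le)
next
  fix Z assume Z: "Z \<in> Upper Q ((\<lambda>x. C `` {x}) ` A)"
  then obtain z where z: "z \<in> carrier L" "Z = C `` {z}"
    by (auto simp: Upper_def carrier_Q)
  have le: "(x \<sqinter> z, x) \<in> C" if "x \<in> A" for x
  proof -
    have "C `` {x} \<sqsubseteq>\<^bsub>Q\<^esub> C `` {z}" "x \<in> carrier L"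
      using Z A that unfolding z(2) by (auto simp: Upper_def carrier_Q)
    then show ?thesis using z(1) by (simp add: Q_le_iff)
  qed
  let ?R = "(\<lambda>x. (z \<sqinter> x, x)) ` A"
  have "(\<Squnion>(fst ` ?R), \<Squnion>(snd ` ?R)) \<in> C"
    using le A by (intro cong_sup kset_image) (auto simp: meet_comm)
  then have "(z \<sqinter> \<Squnion>A, \<Squnion>A) \<in> C"
    using meet_kjoin_distrib[OF z(1) A] by (simp add: image_image)
  then show "C `` {\<Squnion>A} \<sqsubseteq>\<^bsub>Q\<^esub> Z"
    using z A kjoin_closed by (simp add: Q_le_iff meet_comm)
qed (use A kjoin_closed in \<open>auto simp: carrier_Q\<close>)

lemma quotient_meet:
  "\<lbrakk>x \<in> carrier L; y \<in> carrier L\<rbrakk> \<Longrightarrow> C `` {x} \<sqinter>\<^bsub>Q\<^esub> C `` {y} = C `` {x \<sqinter> y}"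
  by (simp add: meet_def partial_order.inf_eqI[OF Q_partial_order Q_glb, unfolded meet_def])

lemma quotient_sup:
  "\<lbrakk>A \<subseteq> carrier L; kset \<kappa> A\<rbrakk> \<Longrightarrow> \<Squnion>\<^bsub>Q\<^esub>((\<lambda>x. C `` {x}) ` A) = C `` {\<Squnion>A}"
  by (simp add: partial_order.sup_eqI[OF Q_partial_order Q_lub])

lemma quotient_join:
  "\<lbrakk>x \<in> carrier L; y \<in> carrier L\<rbrakk> \<Longrightarrow> C `` {x} \<squnion>\<^bsub>Q\<^esub> C `` {y} = C `` {x \<squnion> y}"
  using quotient_sup[of "{x, y}"] by (simp add: join_def kset_finite kappa)

lemma quotient_bottom: "\<bottom>\<^bsub>Q\<^esub> = C `` {\<bottom>}"
proof -
  interpret Q: partial_order Q by (rule Q_partial_order)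
  have *: "least Q (C `` {\<bottom>}) (carrier Q)"
    by (auto simp: least_def carrier_Q intro!: Q_le)
  show ?thesis
    unfolding bottom_def[of Q] by (rule some_equality, rule *) (erule Q.least_unique, rule *)
qed

lemma quotient_top: "\<top>\<^bsub>Q\<^esub> = C `` {\<top>}"
proof -
  interpret Q: partial_order Q by (rule Q_partial_order)
  have *: "greatest Q (C `` {\<top>}) (carrier Q)"
    by (auto simp: greatest_def carrier_Q intro!: Q_le)
  show ?thesis
    unfolding top_def[of Q] by (rule some_equality, rule *) (erule Q.greatest_unique, rule *)
qed

lemma kframe_quotient: "kframe Q \<kappa>"
proof -
  interpret Q: partial_order Q by (rule Q_partial_order)
  have lift: "\<exists>B. B \<subseteq> carrier L \<and> kset \<kappa> B \<and> A = (\<lambda>x. C `` {x}) ` B"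
    if A: "A \<subseteq> carrier Q" "kset \<kappa> A" for A
  proof -
    have "\<forall>X\<in>A. \<exists>x. x \<in> carrier L \<and> X = C `` {x}" using A by (auto simp: carrier_Q)
    then obtain f where f: "\<forall>X\<in>A. f X \<in> carrier L \<and> X = C `` {f X}" by metis
    have "(\<lambda>X. C `` {f X}) ` A = (\<lambda>X. X) ` A"
      by (rule image_cong) (use f in metis)+
    then have "A = (\<lambda>x. C `` {x}) ` f ` A" by (simp add: image_image)
    moreover have "f ` A \<subseteq> carrier L" using f by blast
    ultimately show ?thesis using kset_image[OF A(2)] by (intro exI[of _ "f ` A"] conjI)
  qed
  show ?thesis
  proof
    show "\<exists>s. is_lub Q s {X, Y}" if XY: "X \<in> carrier Q" "Y \<in> carrier Q" for X Y
    proof -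
      obtain x y where "x \<in> carrier L" "y \<in> carrier L" "X = C `` {x}" "Y = C `` {y}"
        using XY by (auto simp: carrier_Q)
      then show ?thesis using Q_lub[of "{x, y}"] by (auto simp: kset_finite kappa)
    qed
    show "\<exists>s. is_glb Q s {X, Y}" if XY: "X \<in> carrier Q" "Y \<in> carrier Q" for X Y
    proof -
      obtain x y where "x \<in> carrier L" "y \<in> carrier L" "X = C `` {x}" "Y = C `` {y}"
        using XY by (auto simp: carrier_Q)
      then show ?thesis using Q_glb by blast
    qed
    show "\<exists>x. least Q x (carrier Q)"
      by (rule exI[of _ "C `` {\<bottom>}"]) (auto simp: least_def carrier_Q intro!: Q_le)
    show "\<exists>x. greatest Q x (carrier Q)"
      by (rule exI[of _ "C `` {\<top>}"]) (auto simp: greatest_def carrier_Q intro!: Q_le)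
    show "regular_or_infty \<kappa>" by (rule kappa)
    show "X \<sqinter>\<^bsub>Q\<^esub> (Y \<squnion>\<^bsub>Q\<^esub> Z) = X \<sqinter>\<^bsub>Q\<^esub> Y \<squnion>\<^bsub>Q\<^esub> X \<sqinter>\<^bsub>Q\<^esub> Z"
      if "X \<in> carrier Q" "Y \<in> carrier Q" "Z \<in> carrier Q" for X Y Z
      using that by (auto simp: carrier_Q quotient_meet quotient_join meet_join_distrib)
    show "\<exists>s. is_lub Q s A" if "A \<subseteq> carrier Q" "kset \<kappa> A" for A
      using lift[OF that] Q_lub by blast
    show "X \<sqinter>\<^bsub>Q\<^esub> \<Squnion>\<^bsub>Q\<^esub>A = \<Squnion>\<^bsub>Q\<^esub>((\<lambda>Y. X \<sqinter>\<^bsub>Q\<^esub> Y) ` A)"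
      if X: "X \<in> carrier Q" and A: "A \<subseteq> carrier Q" "kset \<kappa> A" for X A
    proof -
      obtain x where x: "x \<in> carrier L" "X = C `` {x}" using X by (auto simp: carrier_Q)
      obtain B where B: "B \<subseteq> carrier L" "kset \<kappa> B" "A = (\<lambda>x. C `` {x}) ` B"
        using lift[OF A] by blast
      have "(\<lambda>Y. X \<sqinter>\<^bsub>Q\<^esub> Y) ` A = (\<lambda>y. C `` {y}) ` ((\<lambda>b. x \<sqinter> b) ` B)"
        unfolding B(3) x(2) image_image using x(1) B(1) by (intro image_cong) (auto simp: quotient_meet)
      moreover have "(\<lambda>b. x \<sqinter> b) ` B \<subseteq> carrier L" using x B by auto
      ultimately show ?thesis
        using x B by (simp add: quotient_sup kset_image quotient_meet kjoin_closed meet_kjoin_distrib)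
    qed
  qed
qed

lemma dense_sub_largest_dense:
  assumes "dense_kcongruence L \<kappa> C"
  shows "C \<subseteq> largest_dense L"
proof -
  have *: "d = \<bottom>" if "(\<bottom>, d) \<in> C" for d using assms that by (auto simp: dense_kcongruence_def)
  have imp: "b \<sqinter> x = \<bottom>" if "(a, b) \<in> C" "x \<in> carrier L" "a \<sqinter> x = \<bottom>" for a b x
    using *[of "b \<sqinter> x"] cong_meet[OF that(1) cong_refl[OF that(2)]] that(3) by simp
  show ?thesis
  proof clarify
    fix a b assume ab: "(a, b) \<in> C"
    have "\<forall>x\<in>carrier L. a \<sqinter> x = \<bottom> \<longleftrightarrow> b \<sqinter> x = \<bottom>"
      using imp[OF ab] imp[OF cong_sym[OF ab]] by blast
    then show "(a, b) \<in> largest_dense L"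
      using cong_carrier[OF ab] by (simp add: largest_dense_def)
  qed
qed

end

lemma sup_meet_bottom_iff:
  assumes "A \<subseteq> carrier L" "kset \<kappa> A" "x \<in> carrier L"
  shows "\<Squnion>A \<sqinter> x = \<bottom> \<longleftrightarrow> (\<forall>a\<in>A. a \<sqinter> x = \<bottom>)"
proof
  assume "\<Squnion>A \<sqinter> x = \<bottom>"
  show "\<forall>a\<in>A. a \<sqinter> x = \<bottom>"
  proof
    fix a assume a: "a \<in> A"
    have "a \<sqinter> x \<sqsubseteq> \<Squnion>A \<sqinter> x"
      using a assms kjoin_closed kjoin_upper
      by (meson le_trans meet_closed meet_le meet_left meet_right subsetD)
    then show "a \<sqinter> x = \<bottom>"
      using \<open>\<Squnion>A \<sqinter> x = \<bottom>\<close> a assms by (metis le_bottom meet_closed subsetD)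
  qed
next
  assume *: "\<forall>a\<in>A. a \<sqinter> x = \<bottom>"
  have "\<Squnion>A \<sqinter> x = \<Squnion>((\<lambda>a. x \<sqinter> a) ` A)"
    using assms meet_kjoin_distrib meet_comm by metis
  moreover have "\<Squnion>((\<lambda>a. x \<sqinter> a) ` A) \<sqsubseteq> \<bottom>"
    using assms * by (intro kjoin_least kset_image) (auto simp: meet_comm)
  moreover have "\<Squnion>A \<sqinter> x \<in> carrier L" using assms kjoin_closed by simp
  ultimately show "\<Squnion>A \<sqinter> x = \<bottom>" using le_bottom by metis
qed

lemma largest_dense_is_dense: "dense_kcongruence L \<kappa> (largest_dense L)"
proof -
  let ?D = "largest_dense L"
  have "equiv (carrier L) ?D"
    by (auto simp: equiv_def refl_on_def sym_def trans_def largest_dense_def)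
  moreover have "(a \<sqinter> c, b \<sqinter> d) \<in> ?D" if "(a, b) \<in> ?D" "(c, d) \<in> ?D" for a b c d
  proof -
    have ab: "a \<in> carrier L" "b \<in> carrier L" "c \<in> carrier L" "d \<in> carrier L"
      using that by (auto simp: largest_dense_def)
    have "(a \<sqinter> c) \<sqinter> x = \<bottom> \<longleftrightarrow> (b \<sqinter> d) \<sqinter> x = \<bottom>" if x: "x \<in> carrier L" for x
    proof -
      have "(a \<sqinter> c) \<sqinter> x = \<bottom> \<longleftrightarrow> a \<sqinter> (c \<sqinter> x) = \<bottom>" using ab x by (simp add: meet_assoc')
      also have "\<dots> \<longleftrightarrow> b \<sqinter> (c \<sqinter> x) = \<bottom>"
        using \<open>(a, b) \<in> ?D\<close> ab x by (auto simp: largest_dense_def)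
      also have "\<dots> \<longleftrightarrow> c \<sqinter> (b \<sqinter> x) = \<bottom>" using ab x meet_assoc' meet_comm by metis
      also have "\<dots> \<longleftrightarrow> d \<sqinter> (b \<sqinter> x) = \<bottom>"
        using \<open>(c, d) \<in> ?D\<close> ab x by (auto simp: largest_dense_def)
      also have "\<dots> \<longleftrightarrow> (b \<sqinter> d) \<sqinter> x = \<bottom>" using ab x meet_assoc' meet_comm by metis
      finally show ?thesis .
    qed
    then show ?thesis using ab by (simp add: largest_dense_def)
  qed
  moreover have "(\<Squnion>(fst ` R), \<Squnion>(snd ` R)) \<in> ?D" if R: "R \<subseteq> ?D" "kset \<kappa> R" for R
  proof -
    have c: "fst ` R \<subseteq> carrier L" "snd ` R \<subseteq> carrier L"
      using R by (auto simp: largest_dense_def)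
    have k: "kset \<kappa> (fst ` R)" "kset \<kappa> (snd ` R)" using R kset_image by auto
    have "\<Squnion>(fst ` R) \<sqinter> x = \<bottom> \<longleftrightarrow> \<Squnion>(snd ` R) \<sqinter> x = \<bottom>" if "x \<in> carrier L" for x
      unfolding sup_meet_bottom_iff[OF c(1) k(1) that] sup_meet_bottom_iff[OF c(2) k(2) that]
      using R that by (fastforce simp: largest_dense_def)
    then show ?thesis using c k kjoin_closed by (simp add: largest_dense_def)
  qed
  moreover have "a = \<bottom>" if "(\<bottom>, a) \<in> ?D" for a
  proof -
    have a: "a \<in> carrier L" using that by (simp add: largest_dense_def)
    have "\<bottom> \<sqinter> a = \<bottom>" using a by (simp add: le_meet_eq)
    then have "a \<sqinter> a = \<bottom>" using that a by (simp add: largest_dense_def)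
    then show ?thesis using a by (simp add: le_meet_eq)
  qed
  ultimately show ?thesis by (auto simp: dense_kcongruence_def kcongruence_def)
qed

end

end

theory Submission
  imports Defs
begin

text \<open>
  A Boolean \<open>\<kappa>\<close>-frame is clear: if \<open>a\<close> and \<open>b\<close> annihilate the same elements and \<open>c\<close> is a complement
  of \<open>b\<close>, then \<open>a \<sqinter> c = \<bottom>\<close>, so \<open>a \<sqsubseteq> b\<close>, and \<open>b \<sqsubseteq> a\<close> by symmetry.  As complements survive in
  quotients, every quotient of a Boolean \<open>\<kappa>\<close>-frame is clear.

  Conversely, let every quotient be clear and let \<open>a\<close> be any element.  The annihilator
  \<open>I = {x. a \<sqinter> x = \<bottom>}\<close> is closed under \<open>\<kappa>\<close>-joins, so that ``\<open>x \<sqsubseteq> y\<close> up to an element of \<open>I\<close>'' is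
  the preorder of a congruence (\<open>kcongruence_cong_mod\<close>).  In the quotient \<open>a\<close> has become dense:
  if \<open>a \<sqinter> x \<sqsubseteq> i\<close> with \<open>i \<in> I\<close>, then \<open>a \<sqinter> x = a \<sqinter> (a \<sqinter> x) \<sqsubseteq> a \<sqinter> i = \<bottom>\<close>, that is, \<open>x \<in> I\<close>.  So \<open>a\<close> and
  \<open>\<top>\<close> annihilate the same elements of the quotient, and clearness identifies them.
  This says \<open>\<top> \<sqsubseteq> a \<squnion> i\<close> for some \<open>i \<in> I\<close>, and this \<open>i\<close> is a complement of \<open>a\<close>.

  The annihilator is used because \<open>a\<close> may have no pseudocomplement when \<open>\<kappa> \<noteq> \<infinity>\<close>; for \<open>\<kappa> = \<infinity>\<close> the
  quotient is the closed one determined by the pseudocomplement of \<open>a\<close>.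
\<close>

section \<open>Collapsing a set of elements, and annihilators\<close>

text \<open>
  When \<open>I\<close> is closed under \<open>\<kappa>\<close>-joins, \<open>cong_mod L I\<close> is the congruence that collapses the
  \<open>\<kappa>\<close>-ideal generated by \<open>I\<close> to \<open>\<bottom>\<close>.  Defining it by two inequalities, each with its own error
  term, makes symmetry immediate and leaves one-sided proofs for the operations.
\<close>

definition le_mod :: "('a, 'm) gorder_scheme \<Rightarrow> 'a set \<Rightarrow> 'a \<Rightarrow> 'a \<Rightarrow> bool" where
  "le_mod L I x y \<longleftrightarrow> (\<exists>i\<in>I. x \<sqsubseteq>\<^bsub>L\<^esub> y \<squnion>\<^bsub>L\<^esub> i)"

definition cong_mod :: "('a, 'm) gorder_scheme \<Rightarrow> 'a set \<Rightarrow> 'a rel" where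
  "cong_mod L I =
     {(x, y). x \<in> carrier L \<and> y \<in> carrier L \<and> le_mod L I x y \<and> le_mod L I y x}"

definition annihilator :: "('a, 'm) gorder_scheme \<Rightarrow> 'a \<Rightarrow> 'a set" where
  "annihilator L a = {x \<in> carrier L. a \<sqinter>\<^bsub>L\<^esub> x = \<bottom>\<^bsub>L\<^esub>}"

section \<open>Inequalities in a distributive lattice\<close>

context kframe
begin

lemma le_join_left:
  "\<lbrakk>x \<sqsubseteq> y; x \<in> carrier L; y \<in> carrier L; z \<in> carrier L\<rbrakk> \<Longrightarrow> x \<sqsubseteq> y \<squnion> z"
  using le_trans[OF _ join_left] by simp

lemma le_join_right:
  "\<lbrakk>x \<sqsubseteq> z; x \<in> carrier L; y \<in> carrier L; z \<in> carrier L\<rbrakk> \<Longrightarrow> x \<sqsubseteq> y \<squnion> z"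
  using le_trans[OF _ join_right] by simp

lemma join_meet_distrib:
  assumes "x \<in> carrier L" "y \<in> carrier L" "z \<in> carrier L"
  shows "(x \<squnion> z) \<sqinter> (y \<squnion> z) \<sqsubseteq> (x \<sqinter> y) \<squnion> z"
proof -
  have "(x \<squnion> z) \<sqinter> (y \<squnion> z) = ((x \<squnion> z) \<sqinter> y) \<squnion> ((x \<squnion> z) \<sqinter> z)"
    using assms by (simp add: meet_join_distrib)
  also have "(x \<squnion> z) \<sqinter> y = (x \<sqinter> y) \<squnion> (z \<sqinter> y)"
    using assms by (simp add: meet_comm[of L _ y] meet_join_distrib)
  finally have eq: "(x \<squnion> z) \<sqinter> (y \<squnion> z) = ((x \<sqinter> y) \<squnion> (z \<sqinter> y)) \<squnion> ((x \<squnion> z) \<sqinter> z)" .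
  have "z \<sqinter> y \<sqsubseteq> (x \<sqinter> y) \<squnion> z"
    using assms by (intro le_join_right meet_left) auto
  moreover have "(x \<squnion> z) \<sqinter> z \<sqsubseteq> (x \<sqinter> y) \<squnion> z"
    using assms by (intro le_join_right meet_right) auto
  ultimately show ?thesis
    unfolding eq using assms by (intro join_le) (auto simp: join_left)
qed

lemma join_mono_right:
  assumes "x \<in> carrier L" "y \<in> carrier L" "z \<in> carrier L" "y \<sqsubseteq> z"
  shows "x \<squnion> y \<sqsubseteq> x \<squnion> z"
  using assms by (intro join_le join_left le_join_right) auto

lemma le_complement:
  assumes "a \<in> carrier L" "b \<in> carrier L" "c \<in> carrier L"
    and "a \<sqinter> c = \<bottom>" "b \<squnion> c = \<top>"
  shows "a \<sqsubseteq> b"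
proof -
  have "a = a \<sqinter> (b \<squnion> c)" using assms by (simp add: le_meet_eq)
  also have "\<dots> = (a \<sqinter> b) \<squnion> \<bottom>" using assms(1-4) by (simp add: meet_join_distrib)
  also have "\<dots> \<sqsubseteq> b" using assms by (intro join_le) (auto simp: meet_right)
  finally show ?thesis .
qed

section \<open>Boolean frames and their quotients\<close>

lemma boolean_clear:
  assumes "boolean_kframe L"
  shows "clear_kframe L"
proof -
  have le: "a \<sqsubseteq> b" if ab: "(a, b) \<in> largest_dense L" for a b
  proof -
    have car: "a \<in> carrier L" "b \<in> carrier L" using ab by (auto simp: largest_dense_def)
    then obtain c where c: "c \<in> carrier L" "b \<sqinter> c = \<bottom>" "b \<squnion> c = \<top>"
      using assms by (auto simp: boolean_kframe_def)
    have "a \<sqinter> c = \<bottom>" using ab c by (auto simp: largest_dense_def)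
    then show ?thesis using le_complement car c by blast
  qed
  have "a = b" if ab: "(a, b) \<in> largest_dense L" for a b
  proof -
    have "(b, a) \<in> largest_dense L" using ab by (auto simp: largest_dense_def)
    then show ?thesis
      using le[OF ab] le[of b a] ab le_antisym by (auto simp: largest_dense_def)
  qed
  then have "largest_dense L \<subseteq> Id_on (carrier L)"
    unfolding Id_on_def largest_dense_def by blast
  moreover have "Id_on (carrier L) \<subseteq> largest_dense L" by (auto simp: largest_dense_def)
  ultimately show ?thesis by (simp add: clear_kframe_def)
qed

lemma boolean_quotient:
  assumes "boolean_kframe L" and C: "kcongruence L \<kappa> C"
  shows "boolean_kframe (quotient_kframe L C)"
  unfolding boolean_kframe_def carrier_Q[OF C]
proof clarify
  fix a assume a: "a \<in> carrier L"
  then obtain b where b: "b \<in> carrier L" "a \<sqinter> b = \<bottom>" "a \<squnion> b = \<top>"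
    using assms by (auto simp: boolean_kframe_def)
  show "\<exists>Y\<in>(\<lambda>x. C `` {x}) ` carrier L.
      C `` {a} \<sqinter>\<^bsub>quotient_kframe L C\<^esub> Y = \<bottom>\<^bsub>quotient_kframe L C\<^esub> \<and>
      C `` {a} \<squnion>\<^bsub>quotient_kframe L C\<^esub> Y = \<top>\<^bsub>quotient_kframe L C\<^esub>"
    using a b
    by (intro bexI[of _ "C `` {b}"])
      (simp_all add: quotient_meet[OF C] quotient_join[OF C] quotient_bottom[OF C] quotient_top[OF C])
qed

section \<open>The congruence collapsing a set closed under joins\<close>

context
  fixes I
  assumes I: "I \<subseteq> carrier L"
    and I_join: "\<And>A. \<lbrakk>A \<subseteq> I; kset \<kappa> A\<rbrakk> \<Longrightarrow> \<Squnion>A \<in> I"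
begin

lemma join_in_I: "\<lbrakk>i \<in> I; j \<in> I\<rbrakk> \<Longrightarrow> i \<squnion> j \<in> I"
  using I_join[of "{i, j}"] by (simp add: join_def kset_finite kappa)

lemma le_mod_weaken:
  assumes "x \<sqsubseteq> y \<squnion> i" "i \<sqsubseteq> k" "x \<in> carrier L" "y \<in> carrier L" "i \<in> I" "k \<in> I"
  shows "x \<sqsubseteq> y \<squnion> k"
proof -
  have "i \<in> carrier L" "k \<in> carrier L" using assms I by auto
  then show ?thesis using assms join_mono_right[of y i k] le_trans[of x "y \<squnion> i" "y \<squnion> k"] by simp
qed

lemma le_mod_refl:
  assumes "x \<in> carrier L"
  shows "le_mod L I x x"
proof -
  have "\<Squnion>{} \<in> I" by (rule I_join) (auto simp: kset_finite kappa)
  moreover have "x \<sqsubseteq> x \<squnion> \<Squnion>{}" using assms I calculation by (intro join_left) auto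
  ultimately show ?thesis by (auto simp: le_mod_def)
qed

lemma le_mod_trans:
  assumes "le_mod L I x y" "le_mod L I y z" "x \<in> carrier L" "y \<in> carrier L" "z \<in> carrier L"
  shows "le_mod L I x z"
proof -
  obtain i j where ij: "i \<in> I" "x \<sqsubseteq> y \<squnion> i" "j \<in> I" "y \<sqsubseteq> z \<squnion> j"
    using assms by (auto simp: le_mod_def)
  have car: "i \<in> carrier L" "j \<in> carrier L" using ij I by auto
  let ?k = "i \<squnion> j"
  have k: "?k \<in> I" using ij join_in_I by blast
  have "y \<sqsubseteq> z \<squnion> ?k"
    by (rule le_mod_weaken[OF ij(4)]) (use ij car k assms join_right in auto)
  moreover have "i \<sqsubseteq> z \<squnion> ?k"
    using car assms by (intro le_join_right join_left) auto
  ultimately have "y \<squnion> i \<sqsubseteq> z \<squnion> ?k" using car assms by (simp add: join_le)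
  then have "x \<sqsubseteq> z \<squnion> ?k" using ij car assms le_trans[of x "y \<squnion> i"] by simp
  then show ?thesis using k by (auto simp: le_mod_def)
qed

lemma le_mod_meet:
  assumes "le_mod L I a b" "le_mod L I c d"
    and "a \<in> carrier L" "b \<in> carrier L" "c \<in> carrier L" "d \<in> carrier L"
  shows "le_mod L I (a \<sqinter> c) (b \<sqinter> d)"
proof -
  obtain i j where ij: "i \<in> I" "a \<sqsubseteq> b \<squnion> i" "j \<in> I" "c \<sqsubseteq> d \<squnion> j"
    using assms by (auto simp: le_mod_def)
  have car: "i \<in> carrier L" "j \<in> carrier L" using ij I by auto
  let ?k = "i \<squnion> j"
  have k: "?k \<in> I" using ij join_in_I by blast
  have kc: "?k \<in> carrier L" using k I by auto
  have ab: "a \<sqsubseteq> b \<squnion> ?k"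
    by (rule le_mod_weaken[OF ij(2)]) (use ij car k assms join_left in auto)
  have cd: "c \<sqsubseteq> d \<squnion> ?k"
    by (rule le_mod_weaken[OF ij(4)]) (use ij car k assms join_right in auto)
  have "a \<sqinter> c \<sqsubseteq> b \<squnion> ?k"
    using le_trans[OF meet_left ab] assms kc by simp
  moreover have "a \<sqinter> c \<sqsubseteq> d \<squnion> ?k"
    using le_trans[OF meet_right cd] assms kc by simp
  ultimately have "a \<sqinter> c \<sqsubseteq> (b \<squnion> ?k) \<sqinter> (d \<squnion> ?k)"
    using assms kc by (simp add: meet_le)
  then have "a \<sqinter> c \<sqsubseteq> (b \<sqinter> d) \<squnion> ?k"
    using le_trans[OF _ join_meet_distrib] assms kc by simp
  then show ?thesis using k by (auto simp: le_mod_def)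
qed

text \<open>
  A single error term serves all pairs of \<open>R\<close> at once: choose one for each pair and join them,
  which is possible because \<open>R\<close>, hence also the set of choices, is a \<open>\<kappa>\<close>-set.
\<close>

lemma le_mod_sup:
  assumes R: "kset \<kappa> R" "fst ` R \<subseteq> carrier L" "snd ` R \<subseteq> carrier L"
    and le: "\<And>r. r \<in> R \<Longrightarrow> le_mod L I (fst r) (snd r)"
  shows "le_mod L I (\<Squnion>(fst ` R)) (\<Squnion>(snd ` R))"
proof -
  have "\<forall>r\<in>R. \<exists>i. i \<in> I \<and> fst r \<sqsubseteq> snd r \<squnion> i" using le unfolding le_mod_def by blast
  then obtain f where f: "\<And>r. r \<in> R \<Longrightarrow> f r \<in> I" "\<And>r. r \<in> R \<Longrightarrow> fst r \<sqsubseteq> snd r \<squnion> f r"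
    by metis
  let ?k = "\<Squnion>(f ` R)" and ?s = "\<Squnion>(snd ` R)"
  have k: "?k \<in> I" using f R by (intro I_join kset_image) auto
  have kc: "?k \<in> carrier L" using k I by auto
  have sc: "?s \<in> carrier L" using R by (simp add: kjoin_closed kset_image)
  have fI: "f ` R \<subseteq> carrier L" using f I by auto
  have "fst r \<sqsubseteq> ?s \<squnion> ?k" if r: "r \<in> R" for r
  proof -
    have car: "fst r \<in> carrier L" "snd r \<in> carrier L" "f r \<in> carrier L"
      using r R fI by auto
    have "snd r \<sqsubseteq> ?s" using r R by (intro kjoin_upper kset_image) auto
    then have "snd r \<sqsubseteq> ?s \<squnion> ?k"
      using car kc sc by (intro le_join_left)
    moreover have "f r \<sqsubseteq> ?k" using r R fI by (intro kjoin_upper kset_image) auto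
    then have "f r \<sqsubseteq> ?s \<squnion> ?k"
      using car kc sc by (intro le_join_right)
    ultimately have "snd r \<squnion> f r \<sqsubseteq> ?s \<squnion> ?k" using car kc sc by (simp add: join_le)
    then show ?thesis using le_trans[OF f(2)[OF r]] car kc sc by simp
  qed
  then have "\<Squnion>(fst ` R) \<sqsubseteq> ?s \<squnion> ?k"
    using R kc sc by (intro kjoin_least kset_image) auto
  then show ?thesis using k by (auto simp: le_mod_def)
qed

lemma kcongruence_cong_mod: "kcongruence L \<kappa> (cong_mod L I)"
proof -
  let ?C = "cong_mod L I"
  have "trans ?C"
  proof (rule transI)
    fix a b c assume "(a, b) \<in> ?C" "(b, c) \<in> ?C"
    then show "(a, c) \<in> ?C"
      using le_mod_trans[of a b c] le_mod_trans[of c b a] by (simp add: cong_mod_def)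
  qed
  then have "equiv (carrier L) ?C"
    by (auto simp: equiv_def refl_on_def sym_def cong_mod_def le_mod_refl)
  moreover have "(a \<sqinter> c, b \<sqinter> d) \<in> ?C" if "(a, b) \<in> ?C" "(c, d) \<in> ?C" for a b c d
    using that le_mod_meet[of a b c d] le_mod_meet[of b a d c] by (simp add: cong_mod_def)
  moreover have "(\<Squnion>(fst ` R), \<Squnion>(snd ` R)) \<in> ?C" if R: "R \<subseteq> ?C" "kset \<kappa> R" for R
  proof -
    have c: "fst ` R \<subseteq> carrier L" "snd ` R \<subseteq> carrier L" using R by (auto simp: cong_mod_def)
    have "le_mod L I (\<Squnion>(fst ` R)) (\<Squnion>(snd ` R))"
      using R c by (intro le_mod_sup) (auto simp: cong_mod_def)
    moreover have "le_mod L I (\<Squnion>(fst ` prod.swap ` R)) (\<Squnion>(snd ` prod.swap ` R))"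
      using R c by (intro le_mod_sup kset_image) (auto simp: cong_mod_def image_image)
    ultimately show ?thesis
      using c R by (simp add: cong_mod_def image_image kjoin_closed kset_image)
  qed
  ultimately show ?thesis unfolding kcongruence_def by blast
qed

end

section \<open>Making an element dense in a quotient\<close>

lemma annihilator_join:
  assumes "a \<in> carrier L" "A \<subseteq> annihilator L a" "kset \<kappa> A"
  shows "\<Squnion>A \<in> annihilator L a"
proof -
  have A: "A \<subseteq> carrier L" using assms by (auto simp: annihilator_def)
  have "\<Squnion>A \<sqinter> a = \<bottom>"
    using assms unfolding sup_meet_bottom_iff[OF A assms(3,1)]
    by (auto simp: annihilator_def meet_comm)
  then show ?thesis using A assms by (simp add: annihilator_def kjoin_closed meet_comm)
qed

lemma bottom_join: "x \<in> carrier L \<Longrightarrow> \<bottom> \<squnion> x = x"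
  by (intro le_antisym join_le join_right) auto

text \<open>
  Collapsing the annihilator collapses nothing outside it, because it is downward closed.
\<close>

lemma cong_mod_bottom_iff:
  assumes a: "a \<in> carrier L" and x: "x \<in> carrier L"
  shows "(x, \<bottom>) \<in> cong_mod L (annihilator L a) \<longleftrightarrow> a \<sqinter> x = \<bottom>"
proof
  assume "(x, \<bottom>) \<in> cong_mod L (annihilator L a)"
  then obtain i where i: "i \<in> carrier L" "a \<sqinter> i = \<bottom>" "x \<sqsubseteq> \<bottom> \<squnion> i"
    by (auto simp: cong_mod_def le_mod_def annihilator_def)
  then have "x \<sqsubseteq> i" by (simp add: bottom_join)
  then have "a \<sqinter> x \<sqsubseteq> a \<sqinter> i"
    using a x i(1) by (intro meet_le meet_left le_trans[OF meet_right]) auto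
  then show "a \<sqinter> x = \<bottom>" using i a x by (simp add: le_bottom)
next
  assume "a \<sqinter> x = \<bottom>"
  then have "x \<in> annihilator L a" using x by (simp add: annihilator_def)
  moreover have "x \<sqsubseteq> \<bottom> \<squnion> x" "\<bottom> \<sqsubseteq> x \<squnion> x" using x by (simp_all add: bottom_join)
  ultimately show "(x, \<bottom>) \<in> cong_mod L (annihilator L a)"
    using x unfolding cong_mod_def le_mod_def by blast
qed

lemma quotients_clear_boolean:
  assumes clear: "\<And>C. kcongruence L \<kappa> C \<Longrightarrow> clear_kframe (quotient_kframe L C)"
  shows "boolean_kframe L"
  unfolding boolean_kframe_def
proof
  fix a assume a: "a \<in> carrier L"
  let ?I = "annihilator L a"
  let ?C = "cong_mod L ?I"
  let ?Q = "quotient_kframe L ?C"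
  have C: "kcongruence L \<kappa> ?C"
    using annihilator_join[OF a] by (intro kcongruence_cong_mod) (auto simp: annihilator_def)
  have zero: "?C `` {y} = ?C `` {\<bottom>} \<longleftrightarrow> a \<sqinter> y = \<bottom>" if "y \<in> carrier L" for y
    using Q_eq_iff[OF C that bottom_closed] cong_mod_bottom_iff[OF a that] by simp
  \<comment> \<open>The class of \<open>a\<close> is dense in the quotient: both sides say that \<open>x\<close> lies in the annihilator.\<close>
  have "?C `` {a} \<sqinter>\<^bsub>?Q\<^esub> ?C `` {x} = \<bottom>\<^bsub>?Q\<^esub> \<longleftrightarrow> ?C `` {\<top>} \<sqinter>\<^bsub>?Q\<^esub> ?C `` {x} = \<bottom>\<^bsub>?Q\<^esub>"
    if x: "x \<in> carrier L" for x
  proof -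
    have "a \<sqinter> (a \<sqinter> x) = a \<sqinter> x"
      using a x by (simp add: meet_assoc'[symmetric] le_meet_eq)
    moreover have "\<top> \<sqinter> x = x"
      using x by (simp add: le_meet_eq meet_comm[of L \<top>])
    ultimately show ?thesis
      using a x by (simp add: quotient_meet[OF C] quotient_bottom[OF C] zero)
  qed
  then have "(?C `` {a}, ?C `` {\<top>}) \<in> largest_dense ?Q"
    using a by (auto simp: largest_dense_def carrier_Q[OF C])
  then have "?C `` {a} = ?C `` {\<top>}" using clear[OF C] by (auto simp: clear_kframe_def)
  then have "(\<top>, a) \<in> ?C" using Q_eq_iff[OF C] a cong_sym[OF C] by simp
  then obtain i where i: "i \<in> carrier L" "a \<sqinter> i = \<bottom>" "\<top> \<sqsubseteq> a \<squnion> i"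
    by (auto simp: cong_mod_def le_mod_def annihilator_def)
  then have "a \<squnion> i = \<top>" using a by (intro le_antisym) auto
  then show "\<exists>b\<in>carrier L. a \<sqinter> b = \<bottom> \<and> a \<squnion> b = \<top>" using i by blast
qed

end

theorem mainTheorem4:
  fixes L :: "('a, 'm) gorder_scheme" and \<kappa> :: "'k rel option"
  assumes "kframe L \<kappa>"
  shows "(\<forall>C. kcongruence L \<kappa> C \<longrightarrow> clear_kframe (quotient_kframe L C)) \<longleftrightarrow> boolean_kframe L"
proof -
  interpret kframe L \<kappa> by (rule assms)
  show ?thesis
  proof
    show "boolean_kframe L"
      if "\<forall>C. kcongruence L \<kappa> C \<longrightarrow> clear_kframe (quotient_kframe L C)"
      using that by (intro quotients_clear_boolean) simp
    show "\<forall>C. kcongruence L \<kappa> C \<longrightarrow> clear_kframe (quotient_kframe L C)"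
      if "boolean_kframe L"
      using kframe.boolean_clear[OF kframe_quotient boolean_quotient[OF that]] by simp
  qed
qed

end
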